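(* In the Frobenius metric the discrete action $$\sum_t\|P(t)-P(t-1)\|^2$$ is the time-discretisation of the flat analogue of the Benamou-Brenier kinetic energy of the operator path in the space of substochastic matrices.
   Context: $P(t)$, at integer times $t$ (unit time step), is a sequence of substochastic matrices of a common size, that is, matrices with non-negative entries whose column sums (sources indexing columns) are at most $1$; $\|\cdot\|$ is the Frobenius norm. The Benamou-Brenier formulation reads optimal transport as the search for the curve of least kinetic energy between two marginals. Its flat analogue on the operator space keeps only the kinetic-energy functional, in the Frobenius geometry and with no weighting density of the form $\rho|v|^2$: for a path $\tau\mapsto P(\tau)$ of substochastic matrices, $\tau\in[0,T]$, it is $\int_0^T\|\dot P(\tau)\|^2\,d\tau$. *)

theory Defs
  imports "HOL-Analysis.Analysis"
begin

text \<open>A matrix of type \<open>real ^ 'n ^ 'm\<close> has rows indexed by \<open>'m\<close> (targets) and columns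
  indexed by \<open>'n\<close> (sources); \<open>A $ i $ j\<close> is the entry in row \<open>i\<close>, column \<open>j\<close>.\<close>

definition substochastic :: "real ^ 'n ^ 'm \<Rightarrow> bool" where
  "substochastic A \<longleftrightarrow> (\<forall>i j. 0 \<le> A $ i $ j) \<and> (\<forall>j. (\<Sum>i\<in>UNIV. A $ i $ j) \<le> 1)"

definition frobenius :: "real ^ 'n ^ 'm \<Rightarrow> real" where
  "frobenius A = sqrt (\<Sum>i\<in>UNIV. \<Sum>j\<in>UNIV. (A $ i $ j)\<^sup>2)"

lemma frobenius_eq_norm: "frobenius A = norm A"
  by (simp add: frobenius_def norm_vec_def L2_set_def sum_nonneg)

definition discrete_action :: "nat \<Rightarrow> (nat \<Rightarrow> real ^ 'n ^ 'm) \<Rightarrow> real" where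
  "discrete_action T P = (\<Sum>t = 1..T. (frobenius (P t - P (t - 1)))\<^sup>2)"

definition velocity :: "real \<Rightarrow> (real \<Rightarrow> real ^ 'n ^ 'm) \<Rightarrow> real \<Rightarrow> real ^ 'n ^ 'm" where
  "velocity T Q \<tau> = vector_derivative Q (at \<tau> within {0..T})"

definition kinetic_energy :: "real \<Rightarrow> (real \<Rightarrow> real ^ 'n ^ 'm) \<Rightarrow> real" where
  "kinetic_energy T Q = integral {0..T} (\<lambda>\<tau>. (frobenius (velocity T Q \<tau>))\<^sup>2)"

text \<open>The curves on which the kinetic energy is defined and finite: absolutely continuous with
  square-integrable velocity. Absolute continuity is expressed as differentiability almost
  everywhere together with recovery of the curve from its velocity by integration. This covers
  smooth, piecewise smooth and Lipschitz curves. The first condition is needed because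
  \<open>vector_derivative\<close> is an unspecified value where the derivative does not exist.\<close>

definition finite_energy_curve :: "real \<Rightarrow> (real \<Rightarrow> real ^ 'n ^ 'm) \<Rightarrow> bool" where
  "finite_energy_curve T Q \<longleftrightarrow>
     (\<exists>N. negligible N \<and> (\<forall>\<tau>\<in>{0..T} - N. Q differentiable (at \<tau> within {0..T}))) \<and>
     (\<forall>s t. 0 \<le> s \<longrightarrow> s \<le> t \<longrightarrow> t \<le> T \<longrightarrow> (velocity T Q has_integral (Q t - Q s)) {s..t}) \<and>
     (\<lambda>\<tau>. (frobenius (velocity T Q \<tau>))\<^sup>2) integrable_on {0..T}"

definition operator_path :: "real \<Rightarrow> (real \<Rightarrow> real ^ 'n ^ 'm) \<Rightarrow> bool" where
  "operator_path T Q \<longleftrightarrow> (\<forall>\<tau>\<in>{0..T}. substochastic (Q \<tau>)) \<and> finite_energy_curve T Q"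

text \<open>Time-discretisation of the kinetic energy on the grid \<open>0, h, 2 h, \<dots>, N h\<close>: the velocity
  is replaced by the backward difference quotient and the integral by the Riemann sum over
  the grid cells.\<close>

definition discretised_energy :: "real \<Rightarrow> nat \<Rightarrow> (real \<Rightarrow> real ^ 'n ^ 'm) \<Rightarrow> real" where
  "discretised_energy h N Q =
     (\<Sum>k = 1..N. h * (frobenius ((1 / h) *\<^sub>R (Q (real k * h) - Q ((real k - 1) * h))))\<^sup>2)"

definition interpolates :: "nat \<Rightarrow> (real \<Rightarrow> real ^ 'n ^ 'm) \<Rightarrow> (nat \<Rightarrow> real ^ 'n ^ 'm) \<Rightarrow> bool" where
  "interpolates T Q P \<longleftrightarrow> (\<forall>t\<le>T. Q (real t) = P t)"

text \<open>Piecewise affine interpolation of a sequence given at the times \<open>0, 1, 2, \<dots>\<close>; it is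
  meant for \<open>\<tau> \<ge> 0\<close>.\<close>

definition affine_interpolation :: "(nat \<Rightarrow> real ^ 'n ^ 'm) \<Rightarrow> real \<Rightarrow> real ^ 'n ^ 'm" where
  "affine_interpolation P \<tau> =
     (1 - frac \<tau>) *\<^sub>R P (nat \<lfloor>\<tau>\<rfloor>) + frac \<tau> *\<^sub>R P (Suc (nat \<lfloor>\<tau>\<rfloor>))"

end

theory Submission
  imports Defs
begin

text \<open>Over a cell of length \<open>h\<close> the difference quotient of a curve is the mean of its velocity,
  so by Jensen's inequality no discretised energy exceeds the kinetic energy. Conversely the
  difference quotients converge to the velocity wherever the curve is differentiable, hence almost
  everywhere, and Fatou's lemma bounds the kinetic energy by the lower limit of the discretised
  energies. For the affine interpolation the velocity is constant on the unit cells, and the kinetic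
  energy is already the discrete action.\<close>

section \<open>Integration: Fatou's lemma, grid cells, Jensen's inequality\<close>

text \<open>Fatou's lemma bounds \<open>J\<close> by the lower limit of \<open>I\<close>, and
  \<open>le\<close> bounds the upper limit by \<open>J\<close>; the bound on the integrals takes the
  place of a dominating function.\<close>

lemma tendsto_has_integral_Fatou:
  fixes f :: "nat \<Rightarrow> 'a::euclidean_space \<Rightarrow> real"
  assumes f: "\<And>n. (f n has_integral I n) S" and f_nonneg: "\<And>n x. x \<in> S \<Longrightarrow> 0 \<le> f n x"
    and g: "(g has_integral J) S" and g_nonneg: "\<And>x. x \<in> S \<Longrightarrow> 0 \<le> g x"
    and N: "negligible N" and lim: "\<And>x. x \<in> S - N \<Longrightarrow> (\<lambda>n. f n x) \<longlonglongrightarrow> g x"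
    and le: "\<And>n. I n \<le> J"
  shows "I \<longlonglongrightarrow> J"
proof -
  \<comment> \<open>The indicator removes the values off \<open>S\<close>, whose sign is unknown; on
    \<open>S\<close> nothing is truncated by \<open>ennreal\<close>.\<close>
  define u where "u n x = ennreal (indicator S x * f n x)" for n x
  define v where "v x = ennreal (indicator S x * g x)" for x
  have I_nonneg: "0 \<le> I n" for n
    using has_integral_nonneg[OF f] f_nonneg by blast
  \<comment> \<open>Gauge integrability yields Lebesgue measurability, and a negligible set may fail
    to be Borel, hence the completed measure; \<open>nn_integral_completion\<close> leads back to
    Borel measure for the values of the integrals.\<close>
  have meas: "u n \<in> borel_measurable lebesgue" for n
    using has_integral_implies_lebesgue_measurable[OF f[of n]] unfolding u_def by simp
  have u_int: "integral\<^sup>N lebesgue (u n) = ennreal (I n)" for n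
    unfolding u_def nn_integral_completion
    by (rule nn_integral_has_integral_lebesgue[OF f_nonneg f])
  have v_int: "integral\<^sup>N lebesgue v = ennreal J"
    unfolding v_def nn_integral_completion
    by (rule nn_integral_has_integral_lebesgue[OF g_nonneg g])
  have "AE x in lebesgue. x \<notin> N"
    using N by (simp add: negligible_iff_null_sets AE_not_in)
  then have ae: "AE x in lebesgue. v x = liminf (\<lambda>n. u n x)"
  proof (rule AE_mp, intro AE_I2 impI)
    fix x assume "x \<notin> N"
    then have "(\<lambda>n. indicator S x * f n x) \<longlonglongrightarrow> indicator S x * g x"
      using lim[of x] by (cases "x \<in> S") auto
    then have "(\<lambda>n. u n x) \<longlonglongrightarrow> v x"
      unfolding u_def v_def by (rule tendsto_ennrealI)
    then show "v x = liminf (\<lambda>n. u n x)"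
      by (simp add: lim_imp_Liminf)
  qed
  have "ennreal J = (\<integral>\<^sup>+x. liminf (\<lambda>n. u n x) \<partial>lebesgue)"
    using nn_integral_cong_AE[OF ae] v_int by simp
  also have "\<dots> \<le> liminf (\<lambda>n. ennreal (I n))"
    using nn_integral_liminf[of u lebesgue] meas u_int by simp
  finally have J_le: "ennreal J \<le> liminf (\<lambda>n. ennreal (I n))" .
  show ?thesis
  proof (rule order_tendstoI)
    fix a assume "a < J"
    show "\<forall>\<^sub>F n in sequentially. a < I n"
    \<comment> \<open>\<open>ennreal\<close> sends all negative numbers to 0, so it reflects the
      order only above a non-negative \<open>a\<close>; below 0 the sign of \<open>I n\<close>
      decides.\<close>
    proof (cases "a < 0")
      case True
      then show ?thesis using I_nonneg by (auto intro: always_eventually less_le_trans)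
    next
      case False
      then have "ennreal a < liminf (\<lambda>n. ennreal (I n))"
        using \<open>a < J\<close> J_le by (meson ennreal_lessI le_less_trans less_le_trans not_less)
      then have "\<forall>\<^sub>F n in sequentially. ennreal a < ennreal (I n)"
        by (rule less_LiminfD)
      then show ?thesis
        using False by (auto elim!: eventually_mono simp: ennreal_less_iff)
    qed
  next
    fix a assume "J < a"
    then show "\<forall>\<^sub>F n in sequentially. I n < a"
      using le by (auto intro: always_eventually le_less_trans)
  qed
qed

lemma has_integral_cells:
  fixes f :: "real \<Rightarrow> 'a::banach"
  assumes "0 \<le> h"
    and "\<And>k. k < n \<Longrightarrow> (f has_integral I k) {real k * h..real (Suc k) * h}"
  shows "(f has_integral (\<Sum>k<n. I k)) {0..real n * h}"
  using assms(2)
proof (induction n)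
  case 0
  then show ?case by (simp add: has_integral_refl)
next
  case (Suc n)
  have "(f has_integral ((\<Sum>k<n. I k) + I n)) {0..real (Suc n) * h}"
  proof (rule has_integral_combine)
    show "0 \<le> real n * h" "real n * h \<le> real (Suc n) * h"
      using \<open>0 \<le> h\<close> by (auto simp: mult_right_mono)
  qed (use Suc in auto)
  then show ?case by simp
qed

text \<open>Jensen's inequality for the squared norm. With \<open>m\<close> the mean of
  \<open>v\<close>, expanding the square of \<open>norm (v x - m)\<close> gives a lower bound for
  the square of \<open>norm (v x)\<close> that is affine in \<open>v x\<close>, and so can be
  integrated termwise. The mean is the choice of \<open>m\<close> that makes the integrated bound
  largest.\<close>

lemma norm_integral_squared_le:
  fixes v :: "real \<Rightarrow> 'a::euclidean_space"
  assumes ab: "a < b" and v: "(v has_integral w) {a..b}"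
    and v2: "((\<lambda>x. (norm (v x))\<^sup>2) has_integral E) {a..b}"
  shows "(norm w)\<^sup>2 / (b - a) \<le> E"
proof -
  define m where "m = w /\<^sub>R (b - a)"
  have lin: "((\<lambda>x. v x \<bullet> m) has_integral (w \<bullet> m)) {a..b}"
    using has_integral_linear[OF v bounded_linear_inner_left[of m]] by (simp add: comp_def)
  have const: "((\<lambda>x. (norm m)\<^sup>2) has_integral ((b - a) * (norm m)\<^sup>2)) {a..b}"
    using has_integral_const_real[of "(norm m)\<^sup>2" a b] ab by simp
  have "((\<lambda>x. 2 * (v x \<bullet> m) - (norm m)\<^sup>2) has_integral (2 * (w \<bullet> m) - (b - a) * (norm m)\<^sup>2)) {a..b}"
    by (intro has_integral_diff has_integral_mult_right lin const)
  moreover have "2 * (v x \<bullet> m) - (norm m)\<^sup>2 \<le> (norm (v x))\<^sup>2" for x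
  proof -
    have "0 \<le> (norm (v x - m))\<^sup>2" by simp
    then show ?thesis
      unfolding power2_norm_eq_inner by (simp add: inner_diff_left inner_diff_right inner_commute)
  qed
  ultimately have "2 * (w \<bullet> m) - (b - a) * (norm m)\<^sup>2 \<le> E"
    using has_integral_le v2 by blast
  moreover have "2 * (w \<bullet> m) - (b - a) * (norm m)\<^sup>2 = (norm w)\<^sup>2 / (b - a)"
    using ab unfolding m_def power2_norm_eq_inner by (simp add: divide_simps)
  ultimately show ?thesis by simp
qed

section \<open>Convergence of difference quotients\<close>

text \<open>A grid cell contains \<open>x\<close> but need not have it as an endpoint. As
  \<open>a\<close> and \<open>b\<close> lie on opposite sides of \<open>x\<close>, the first-order
  errors \<open>e * (b - x)\<close> and \<open>e * (x - a)\<close> add up to exactly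
  \<open>e * (b - a)\<close>, which survives division by \<open>b - a\<close>.\<close>

lemma straddling_difference_quotient:
  fixes Q :: "real \<Rightarrow> 'a::real_normed_vector"
  assumes "(Q has_vector_derivative v) (at x within S)" and "0 < e"
  obtains d where "0 < d"
    and "\<And>a b. \<lbrakk>a \<in> S; b \<in> S; a \<le> x; x \<le> b; a < b; b - a < d\<rbrakk>
           \<Longrightarrow> norm ((1 / (b - a)) *\<^sub>R (Q b - Q a) - v) \<le> e"
proof -
  obtain d where d: "0 < d"
    and D: "\<And>y. y \<in> S \<Longrightarrow> norm (y - x) < d \<Longrightarrow>
              norm (Q y - Q x - (y - x) *\<^sub>R v) \<le> e * norm (y - x)"
    using assms unfolding has_vector_derivative_def has_derivative_within_alt by blast
  show thesis
  proof (rule that[OF d])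
    fix a b assume ab: "a \<in> S" "b \<in> S" "a \<le> x" "x \<le> b" "a < b" "b - a < d"
    have "norm (Q b - Q a - (b - a) *\<^sub>R v)
        = norm ((Q b - Q x - (b - x) *\<^sub>R v) - (Q a - Q x - (a - x) *\<^sub>R v))"
      by (simp add: algebra_simps)
    also have "\<dots> \<le> norm (Q b - Q x - (b - x) *\<^sub>R v) + norm (Q a - Q x - (a - x) *\<^sub>R v)"
      by (rule norm_triangle_ineq4)
    also have "\<dots> \<le> e * (b - x) + e * (x - a)"
      using D[of a] D[of b] ab by (intro add_mono) auto
    also have "\<dots> = e * (b - a)" by (simp add: algebra_simps)
    finally have "norm (Q b - Q a - (b - a) *\<^sub>R v) \<le> e * (b - a)" .
    moreover have "(1 / (b - a)) *\<^sub>R (Q b - Q a) - v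
        = (1 / (b - a)) *\<^sub>R (Q b - Q a - (b - a) *\<^sub>R v)"
      using ab by (simp add: scaleR_right_diff_distrib)
    moreover have "0 < b - a" using ab by simp
    ultimately show "norm ((1 / (b - a)) *\<^sub>R (Q b - Q a) - v) \<le> e"
      by (simp add: pos_divide_le_eq del: diff_gt_0_iff_gt)
  qed
qed

text \<open>The step function equal, on each half-open cell of the grid of width \<open>h\<close>,
  to the difference quotient of \<open>Q\<close> over that cell. It turns the Riemann sum into an
  integral, to which Fatou's lemma applies.\<close>

definition cell_quotient :: "real \<Rightarrow> (real \<Rightarrow> 'a::real_normed_vector) \<Rightarrow> real \<Rightarrow> 'a" where
  "cell_quotient h Q x =
     (1 / h) *\<^sub>R (Q (real_of_int (\<lfloor>x / h\<rfloor> + 1) * h) - Q (real_of_int \<lfloor>x / h\<rfloor> * h))"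

lemma cell_quotient_eq:
  assumes "0 < h" "real k * h < x" "x < real (Suc k) * h"
  shows "cell_quotient h Q x = (1 / h) *\<^sub>R (Q (real (Suc k) * h) - Q (real k * h))"
proof -
  have "\<lfloor>x / h\<rfloor> = int k"
    using assms by (intro floor_unique) (auto simp: field_simps)
  then show ?thesis by (simp add: cell_quotient_def add.commute)
qed

text \<open>The end time is excluded: at \<open>x = T\<close> the floor selects the cell to the
  right of \<open>T\<close>, where the derivative within \<open>{0..T}\<close> says nothing about
  \<open>Q\<close>.\<close>

lemma cell_quotient_tendsto:
  fixes Q :: "real \<Rightarrow> 'a::real_normed_vector"
  assumes T: "0 < T" and x: "0 \<le> x" "x < T"
    and Q: "(Q has_vector_derivative v) (at x within {0..T})"
  shows "(\<lambda>n. cell_quotient (T / real (Suc n)) Q x) \<longlonglongrightarrow> v"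
proof (rule LIMSEQ_I)
  fix e :: real assume "0 < e"
  then obtain d where d: "0 < d"
    and D: "\<And>a b. \<lbrakk>a \<in> {0..T}; b \<in> {0..T}; a \<le> x; x \<le> b; a < b; b - a < d\<rbrakk>
              \<Longrightarrow> norm ((1 / (b - a)) *\<^sub>R (Q b - Q a) - v) \<le> e / 2"
    using straddling_difference_quotient[OF Q, of "e / 2"] by auto
  obtain n0 where n0: "T / d < real n0" using reals_Archimedean2 by blast
  show "\<exists>no. \<forall>n\<ge>no. norm (cell_quotient (T / real (Suc n)) Q x - v) < e"
  proof (intro exI allI impI)
    fix n assume "n0 \<le> n"
    define h where "h = T / real (Suc n)"
    have h: "0 < h" and hT: "real (Suc n) * h = T" using T by (auto simp: h_def)
    have "T / d < real (Suc n)" using n0 \<open>n0 \<le> n\<close> by simp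
    then have hd: "h < d" using d unfolding h_def by (simp add: field_simps)
    define k where "k = \<lfloor>x / h\<rfloor>"
    have k0: "0 \<le> k" using x h by (simp add: k_def)
    have lo: "of_int k * h \<le> x" and hi: "x < of_int (k + 1) * h"
      using h floor_correct[of "x / h"]
      by (auto simp: k_def simp flip: pos_le_divide_eq pos_divide_less_eq)
    \<comment> \<open>Here \<open>x < T\<close> enters: it forces \<open>k\<close> to be at most
      \<open>n\<close>, so the right end of the cell stays within \<open>{0..T}\<close>.\<close>
    have "x / h < real (Suc n)" using x hT h by (simp add: pos_divide_less_eq)
    then have "k < int (Suc n)" unfolding k_def by (simp add: floor_less_iff)
    then have "k + 1 \<le> int (Suc n)" by simp
    then have "of_int (k + 1) \<le> real (Suc n)" by linarith
    then have "of_int (k + 1) * h \<le> T" using h hT mult_right_mono by fastforce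
    moreover have "0 \<le> of_int k * h" using k0 h by simp
    moreover have step: "of_int (k + 1) * h - of_int k * h = h" by (simp add: algebra_simps)
    ultimately have "norm ((1 / h) *\<^sub>R (Q (of_int (k + 1) * h) - Q (of_int k * h)) - v) \<le> e / 2"
      using D[of "of_int k * h" "of_int (k + 1) * h"] lo hi h hd x by simp
    then show "norm (cell_quotient (T / real (Suc n)) Q x - v) < e"
      using \<open>0 < e\<close> unfolding cell_quotient_def h_def k_def by linarith
  qed
qed

section \<open>Discretised energies and their limit\<close>

lemma discretised_energy_eq:
  "discretised_energy h n Q =
     (\<Sum>k<n. h * (norm ((1 / h) *\<^sub>R (Q (real (Suc k) * h) - Q (real k * h))))\<^sup>2)"
  unfolding discretised_energy_def frobenius_eq_norm One_nat_def sum.atLeast1_atMost_eq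
  by (simp add: add.commute)

lemma has_integral_cell_quotient:
  assumes "0 < h"
  shows "((\<lambda>x. (norm (cell_quotient h Q x))\<^sup>2) has_integral discretised_energy h n Q)
           {0..real n * h}"
  unfolding discretised_energy_eq
proof (rule has_integral_cells)
  fix k
  let ?c = "(norm ((1 / h) *\<^sub>R (Q (real (Suc k) * h) - Q (real k * h))))\<^sup>2"
  have "((\<lambda>x. ?c) has_integral h * ?c) (cbox (real k * h) (real (Suc k) * h))"
    using has_integral_const_real[of ?c "real k * h" "real (Suc k) * h"] assms
    by (simp add: algebra_simps)
  \<comment> \<open>At the right end of the cell the floor has already moved to the next cell, so
    the integrands are compared on the interior only.\<close>
  then have "((\<lambda>x. (norm (cell_quotient h Q x))\<^sup>2) has_integral h * ?c)
               (cbox (real k * h) (real (Suc k) * h))"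
    by (rule has_integral_spike_interior) (use assms in \<open>auto simp: cell_quotient_eq\<close>)
  then show "((\<lambda>x. (norm (cell_quotient h Q x))\<^sup>2) has_integral h * ?c)
               {real k * h..real (Suc k) * h}"
    by simp
qed (use assms in simp)

text \<open>Each summand is the squared increment divided by \<open>h\<close>, the left side of
  Jensen's inequality on that cell; the energies of the cells add up to \<open>E\<close>.\<close>

lemma discretised_energy_le:
  fixes v :: "real \<Rightarrow> real ^ 'n ^ 'm"
  assumes h: "0 < h"
    and v: "\<And>s t. 0 \<le> s \<Longrightarrow> s \<le> t \<Longrightarrow> t \<le> real n * h \<Longrightarrow> (v has_integral (Q t - Q s)) {s..t}"
    and v2: "((\<lambda>x. (norm (v x))\<^sup>2) has_integral E) {0..real n * h}"
  shows "discretised_energy h n Q \<le> E"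
proof -
  let ?f = "\<lambda>x. (norm (v x))\<^sup>2"
  let ?cell = "\<lambda>k. {real k * h..real (Suc k) * h}"
  have bounds: "0 \<le> real k * h" "real k * h < real (Suc k) * h" "real (Suc k) * h \<le> real n * h"
    if "k < n" for k
    using h that by (auto intro: mult_right_mono simp del: of_nat_Suc)
  have int: "(?f has_integral integral (?cell k) ?f) (?cell k)" if "k < n" for k
  proof (intro integrable_integral integrable_on_subinterval)
    show "?f integrable_on {0..real n * h}" using v2 by (rule has_integral_integrable)
    show "?cell k \<subseteq> {0..real n * h}"
      using bounds[OF that] by (simp del: of_nat_Suc)
  qed
  have "discretised_energy h n Q \<le> (\<Sum>k<n. integral (?cell k) ?f)"
    unfolding discretised_energy_eq
  proof (rule sum_mono)
    fix k assume "k \<in> {..<n}"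
    then have k: "k < n" by simp
    have w: "(v has_integral (Q (real (Suc k) * h) - Q (real k * h))) (?cell k)"
      using v[OF bounds(1) less_imp_le[OF bounds(2)] bounds(3)] k by blast
    have "h * (norm ((1 / h) *\<^sub>R (Q (real (Suc k) * h) - Q (real k * h))))\<^sup>2
        = (norm (Q (real (Suc k) * h) - Q (real k * h)))\<^sup>2 / h"
      using h by (simp add: power_divide power2_eq_square del: of_nat_Suc)
    also have "\<dots> \<le> integral (?cell k) ?f"
      using norm_integral_squared_le[OF bounds(2)[OF k] w int[OF k]] by (simp add: algebra_simps)
    finally show "h * (norm ((1 / h) *\<^sub>R (Q (real (Suc k) * h) - Q (real k * h))))\<^sup>2
        \<le> integral (?cell k) ?f" .
  qed
  also have "\<dots> = E"
    using has_integral_cells[of h n ?f "\<lambda>k. integral (?cell k) ?f"] int h v2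
    by (auto intro: has_integral_unique)
  finally show ?thesis .
qed

lemma discretised_energy_tendsto_kinetic_energy:
  fixes Q :: "real \<Rightarrow> real ^ 'n ^ 'm"
  assumes "0 \<le> T" and Q: "finite_energy_curve T Q"
  shows "(\<lambda>n. discretised_energy (T / real n) n Q) \<longlonglongrightarrow> kinetic_energy T Q"
proof (cases "T = 0")
  \<comment> \<open>With \<open>T = 0\<close> the step is 0, so the factor \<open>h\<close> makes
    every summand vanish, and the integral is over a single point.\<close>
  case True
  then show ?thesis
    by (simp add: discretised_energy_def kinetic_energy_def)
next
  case False
  with \<open>0 \<le> T\<close> have T: "0 < T" by simp
  let ?v = "velocity T Q"
  obtain N where N: "negligible N"
    and diff: "\<And>x. x \<in> {0..T} - N \<Longrightarrow> Q differentiable (at x within {0..T})"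
    using Q unfolding finite_energy_curve_def by blast
  have v: "\<And>s t. 0 \<le> s \<Longrightarrow> s \<le> t \<Longrightarrow> t \<le> T \<Longrightarrow> (?v has_integral (Q t - Q s)) {s..t}"
    using Q unfolding finite_energy_curve_def by blast
  have v2: "((\<lambda>x. (norm (?v x))\<^sup>2) has_integral kinetic_energy T Q) {0..T}"
    using Q unfolding finite_energy_curve_def kinetic_energy_def frobenius_eq_norm
    by (intro integrable_integral) blast
  \<comment> \<open>The shifted index keeps the step positive; at index 0 it would be
    \<open>T / 0 = 0\<close>.\<close>
  have "(\<lambda>n. discretised_energy (T / real (Suc n)) (Suc n) Q) \<longlonglongrightarrow> kinetic_energy T Q"
  proof (rule tendsto_has_integral_Fatou)
    fix n
    show "((\<lambda>x. (norm (cell_quotient (T / real (Suc n)) Q x))\<^sup>2) has_integral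
            discretised_energy (T / real (Suc n)) (Suc n) Q) {0..T}"
      using has_integral_cell_quotient[of "T / real (Suc n)" Q "Suc n"] T
      by (simp del: of_nat_Suc)
    show "discretised_energy (T / real (Suc n)) (Suc n) Q \<le> kinetic_energy T Q"
      using T v v2 by (intro discretised_energy_le[where v = ?v]) (auto simp del: of_nat_Suc)
  next
    show "((\<lambda>x. (norm (?v x))\<^sup>2) has_integral kinetic_energy T Q) {0..T}" by (rule v2)
    \<comment> \<open>The end time joins the exceptional set because \<open>cell_quotient\<close>
      looks beyond \<open>T\<close> there.\<close>
    show "negligible (insert T N)" using N by simp
  next
    fix x assume x: "x \<in> {0..T} - insert T N"
    then have "(Q has_vector_derivative ?v x) (at x within {0..T})"
      using diff[of x] unfolding velocity_def by (simp add: vector_derivative_works)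
    then have "(\<lambda>n. cell_quotient (T / real (Suc n)) Q x) \<longlonglongrightarrow> ?v x"
      using T x by (intro cell_quotient_tendsto) auto
    then show "(\<lambda>n. (norm (cell_quotient (T / real (Suc n)) Q x))\<^sup>2) \<longlonglongrightarrow> (norm (?v x))\<^sup>2"
      by (intro tendsto_intros)
  qed auto
  then show ?thesis by (rule LIMSEQ_imp_Suc)
qed

section \<open>The affine interpolation and its energy\<close>

lemma substochastic_convex_combination:
  assumes A: "substochastic A" and B: "substochastic B" and u: "0 \<le> u" "u \<le> 1"
  shows "substochastic ((1 - u) *\<^sub>R A + u *\<^sub>R B)"
  unfolding substochastic_def
proof (intro conjI allI)
  fix i j
  show "0 \<le> ((1 - u) *\<^sub>R A + u *\<^sub>R B) $ i $ j"
    using A B u by (simp add: substochastic_def)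
  have "(\<Sum>i\<in>UNIV. ((1 - u) *\<^sub>R A + u *\<^sub>R B) $ i $ j)
      = (1 - u) * (\<Sum>i\<in>UNIV. A $ i $ j) + u * (\<Sum>i\<in>UNIV. B $ i $ j)"
    by (simp add: sum.distrib sum_distrib_left)
  also have "\<dots> \<le> (1 - u) * 1 + u * 1"
    using A B u unfolding substochastic_def by (intro add_mono mult_left_mono) auto
  finally show "(\<Sum>i\<in>UNIV. ((1 - u) *\<^sub>R A + u *\<^sub>R B) $ i $ j) \<le> 1" by simp
qed

lemma affine_interpolation_of_nat [simp]: "affine_interpolation P (real t) = P t"
  by (simp add: affine_interpolation_def frac_def)

text \<open>The cell is closed although the floor jumps at its right end: there the fractional part
  is 0 and both formulas give \<open>P (Suc k)\<close>. This agreement is what glues the cells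
  continuously.\<close>

lemma affine_interpolation_cell:
  assumes "real k \<le> x" "x \<le> real (Suc k)"
  shows "affine_interpolation P x = P k + (x - real k) *\<^sub>R (P (Suc k) - P k)"
proof (cases "x = real (Suc k)")
  case True
  then show ?thesis
    using affine_interpolation_of_nat[of P "Suc k"] by simp
next
  case False
  then have "\<lfloor>x\<rfloor> = int k" using assms by (intro floor_unique) auto
  then show ?thesis by (simp add: affine_interpolation_def frac_def algebra_simps)
qed

lemma continuous_on_affine_interpolation: "continuous_on {0..real T} (affine_interpolation P)"
proof (induction T)
  case 0
  then show ?case by simp
next
  case (Suc T)
  have "continuous_on {real T..real (Suc T)} (\<lambda>x. P T + (x - real T) *\<^sub>R (P (Suc T) - P T))"
    by (intro continuous_intros)
  then have "continuous_on {real T..real (Suc T)} (affine_interpolation P)"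
    by (rule continuous_on_eq) (simp add: affine_interpolation_cell[where k = T] del: of_nat_Suc)
  then have "continuous_on ({0..real T} \<union> {real T..real (Suc T)}) (affine_interpolation P)"
    using Suc by (intro continuous_on_closed_Un) auto
  then show ?case by (simp add: ivl_disj_un_two_touch)
qed

lemma affine_interpolation_has_vector_derivative:
  assumes "real k < x" "x < real (Suc k)"
  shows "(affine_interpolation P has_vector_derivative (P (Suc k) - P k)) (at x)"
proof (rule has_vector_derivative_transform_within_open)
  show "((\<lambda>x. P k + (x - real k) *\<^sub>R (P (Suc k) - P k)) has_vector_derivative (P (Suc k) - P k)) (at x)"
    by (auto intro!: derivative_eq_intros)
  show "x \<in> {real k<..<real (Suc k)}" using assms by simp
qed (auto simp: affine_interpolation_cell[where k = k] simp del: of_nat_Suc)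

lemma velocity_affine_interpolation:
  assumes "k < T" "real k < x" "x < real (Suc k)"
  shows "velocity (real T) (affine_interpolation P) x = P (Suc k) - P k"
  unfolding velocity_def
  using assms
  by (intro vector_derivative_at_within_ivl affine_interpolation_has_vector_derivative) auto

text \<open>The integer times are the possible kinks of the interpolation. Being finite in number,
  they serve both as the null set in \<open>finite_energy_curve\<close> and as the exceptional set
  in the fundamental theorem of calculus.\<close>

lemma unit_cell_cases:
  assumes "x \<in> {0..real T} - real ` {..T}"
  obtains k where "k < T" "real k < x" "x < real (Suc k)"
proof
  let ?k = "nat \<lfloor>x\<rfloor>"
  have "real (Suc ?k) = real_of_int \<lfloor>x\<rfloor> + 1" using assms by simp
  then have k: "real ?k \<le> x" "x < real (Suc ?k)"
    by linarith+
  then have "?k \<le> T" using assms by (simp add: nat_le_iff floor_le_iff)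
  then have "real ?k \<noteq> x" using assms by (metis DiffE atMost_iff image_eqI)
  then show "real ?k < x" using k by linarith
  moreover have "x \<le> real T" using assms by simp
  ultimately show "?k < T" by linarith
  show "x < real (Suc ?k)" by (rule k)
qed

text \<open>On an open unit cell the velocity is the constant increment, and the cell has length 1,
  so its energy is the squared increment itself. At a kink \<open>vector_derivative\<close> may be
  unspecified, but such points do not affect the integral.\<close>

lemma affine_interpolation_energy_integral:
  "((\<lambda>x. (frobenius (velocity (real T) (affine_interpolation P) x))\<^sup>2)
      has_integral discrete_action T P) {0..real T}"
proof -
  let ?f = "\<lambda>x. (frobenius (velocity (real T) (affine_interpolation P) x))\<^sup>2"
  let ?c = "\<lambda>k. (frobenius (P (Suc k) - P k))\<^sup>2"
  \<comment> \<open>The factors \<open>* 1\<close> give the cells the shape expected by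
    \<open>has_integral_cells\<close> with \<open>h = 1\<close>.\<close>
  have cell: "(?f has_integral ?c k) {real k * 1..real (Suc k) * 1}" if "k < T" for k
  proof -
    have "((\<lambda>x. ?c k) has_integral ?c k) (cbox (real k) (real (Suc k)))"
      using has_integral_const_real[of "?c k" "real k" "real (Suc k)"] by simp
    then have "(?f has_integral ?c k) (cbox (real k) (real (Suc k)))"
      by (rule has_integral_spike_interior) (use that in \<open>auto simp: velocity_affine_interpolation\<close>)
    then show ?thesis by simp
  qed
  have "discrete_action T P = (\<Sum>k<T. ?c k)"
    unfolding discrete_action_def One_nat_def sum.atLeast1_atMost_eq by simp
  then show ?thesis using has_integral_cells[OF _ cell] by simp
qed

text \<open>Recovery of the curve from its velocity follows from the fundamental theorem of calculus
  with finitely many exceptions; continuity carries it across the kinks.\<close>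

lemma affine_interpolation_finite_energy:
  "finite_energy_curve (real T) (affine_interpolation P)"
  unfolding finite_energy_curve_def
proof (intro conjI exI allI impI ballI)
  let ?Q = "affine_interpolation P"
  show "negligible (real ` {..T})" by (intro negligible_finite) simp
  show "?Q differentiable (at x within {0..real T})" if "x \<in> {0..real T} - real ` {..T}" for x
    using unit_cell_cases[OF that] affine_interpolation_has_vector_derivative
    by (metis differentiable_at_withinI differentiableI_vector)
  show "(velocity (real T) ?Q has_integral (?Q t - ?Q s)) {s..t}"
    if st: "0 \<le> s" "s \<le> t" "t \<le> real T" for s t
  proof (rule fundamental_theorem_of_calculus_strong)
    show "finite (real ` {..T})" by simp
    show "continuous_on {s..t} ?Q"
      using st by (intro continuous_on_subset[OF continuous_on_affine_interpolation[of T]]) auto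
    fix x assume "x \<in> {s..t} - real ` {..T}"
    then have "x \<in> {0..real T} - real ` {..T}" using st by auto
    then obtain k where k: "k < T" "real k < x" "x < real (Suc k)" by (rule unit_cell_cases)
    then show "(?Q has_vector_derivative velocity (real T) ?Q x) (at x)"
      using affine_interpolation_has_vector_derivative[of k x P]
      by (simp add: velocity_affine_interpolation del: of_nat_Suc)
  qed (rule st)
  show "(\<lambda>x. (frobenius (velocity (real T) ?Q x))\<^sup>2) integrable_on {0..real T}"
    using affine_interpolation_energy_integral by (rule has_integral_integrable)
qed

text \<open>Between integer times the curve runs along the segment joining consecutive matrices,
  which stays substochastic by convexity.\<close>

lemma affine_interpolation_operator_path:
  assumes "\<And>t. t \<le> T \<Longrightarrow> substochastic (P t)"
  shows "operator_path (real T) (affine_interpolation P)"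
  unfolding operator_path_def
proof (intro conjI ballI affine_interpolation_finite_energy)
  fix x assume x: "x \<in> {0..real T}"
  show "substochastic (affine_interpolation P x)"
  proof (cases "x \<in> real ` {..T}")
    case True
    then show ?thesis using assms by auto
  next
    case False
    then obtain k where k: "k < T" "real k < x" "x < real (Suc k)"
      using x unit_cell_cases[of x T] by blast
    have "affine_interpolation P x = (1 - (x - real k)) *\<^sub>R P k + (x - real k) *\<^sub>R P (Suc k)"
      using k affine_interpolation_cell[of k x P] by (simp add: algebra_simps)
    then show ?thesis
      using k assms by (simp add: substochastic_convex_combination)
  qed
qed

section \<open>The discrete action as a time-discretisation\<close>

lemma discretised_energy_unit_step:
  assumes "interpolates T Q P"
  shows "discretised_energy 1 T Q = discrete_action T P"
proof -
  have "Q (real (Suc k)) = P (Suc k) \<and> Q (real k) = P k" if "k < T" for k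
    using assms that unfolding interpolates_def by (metis Suc_leI less_imp_le)
  then show ?thesis
    unfolding discretised_energy_eq discrete_action_def frobenius_eq_norm
      One_nat_def sum.atLeast1_atMost_eq
    by (intro sum.cong) (simp_all del: of_nat_Suc)
qed

text \<open>Being the time-discretisation is read as two facts about every operator path through
  \<open>P\<close>: the scheme with unit step gives the action, and the same scheme under refinement
  converges to the kinetic energy. The affine interpolation shows that such paths exist and that the
  action is itself the kinetic energy of one of them.\<close>

theorem proposition1:
  fixes P :: "nat \<Rightarrow> real ^ 'n ^ 'm" and T :: nat
  assumes "\<And>t. t \<le> T \<Longrightarrow> substochastic (P t)"
  shows "(\<forall>Q. operator_path (real T) Q \<and> interpolates T Q P \<longrightarrow>
            discretised_energy 1 T Q = discrete_action T P \<and>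
            (\<lambda>n. discretised_energy (real T / real n) n Q) \<longlonglongrightarrow> kinetic_energy (real T) Q) \<and>
         operator_path (real T) (affine_interpolation P) \<and>
         interpolates T (affine_interpolation P) P \<and>
         kinetic_energy (real T) (affine_interpolation P) = discrete_action T P"
proof (intro conjI allI impI)
  fix Q assume Q: "operator_path (real T) Q \<and> interpolates T Q P"
  then show "discretised_energy 1 T Q = discrete_action T P"
    by (simp add: discretised_energy_unit_step)
  show "(\<lambda>n. discretised_energy (real T / real n) n Q) \<longlonglongrightarrow> kinetic_energy (real T) Q"
    using Q by (simp add: operator_path_def discretised_energy_tendsto_kinetic_energy)
next
  show "operator_path (real T) (affine_interpolation P)"
    using assms by (rule affine_interpolation_operator_path)
  show "interpolates T (affine_interpolation P) P"
    by (simp add: interpolates_def)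
  show "kinetic_energy (real T) (affine_interpolation P) = discrete_action T P"
    unfolding kinetic_energy_def
    using affine_interpolation_energy_integral by (rule integral_unique)
qed

end
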